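(* Let $(\alpha^*,\varphi^{1*},\varphi^{2*},\varphi^{3*},\phi^*,\delta^* )$ be optimal dual variables of $(SDP)$, where - $\alpha^*\in\mathbb{R}^m_+$ is associated with the constraints $\langle Q_r,X\rangle+c_r^Tx\le b_r$, - $\varphi^{1*},\varphi^{2*},\varphi^{3*}\in\mathbb{R}^n_+$ are associated with $X_{ii}-u_ix_i-\ell_ix_i+u_i\ell_i\le0$, $-X_{ii}+2u_ix_i-u_i^2\le0$, $-X_{ii}+2\ell_ix_i-\ell_i^2\le0$ respectively, - $\phi^{t*}_{ij}\ge0$ ($i<j$, $t=1,\dots,4$) is associated with $h^t_{ij}(x,X)\le0$, - $\delta^{t*}_{ijk}\ge0$ ($i<j<k$, $t=1,\dots,12$) is associated with $h^{'t}_{ijk}(x,X)\le0$. Define $$\Phi^*=\sum_{i<j}\sum_{t=1}^4\phi^{t*}_{ij}M^t_{ij}+\mathrm{diag}(\varphi^{1*}-\varphi^{2*}-\varphi^{3*}),\qquad \Delta^*=\sum_{i<j<k}\sum_{t=1}^{12}\delta^{t*}_{ijk}M^{'t}_{ijk},$$ $$S_r^*=\mathbf{0}_n\ (r=1,\dots,m),\qquad S_0^*=Q_0+\sum_{r=1}^m\alpha_r^*Q_r+\Phi^*+\Delta^*.$$ Then $S_0^*,\dots,S_m^*$ are positive semidefinite and $(S_0^*,\ldots,S_m^* )$ is an optimal solution of $$(OPT)\qquad \max_{S_0,\ldots,S_m\succeq 0}\ v(P'_{S_0,\ldots,S_m}),$$ where $v(\cdot)$ denotes optimal value.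
   Context: Data: integers $n\ge 1$, $m\ge 0$; symmetric matrices $Q_0,\dots,Q_m\in\mathbb{R}^{n\times n}$; $c_0,\dots,c_m\in\mathbb{R}^n$; $b\in\mathbb{R}^m$; bounds $\ell,u\in\mathbb{R}^n$ with $0\le\ell_p\le u_p$. $\langle A,B\rangle=\sum_{p,q}a_{pq}b_{pq}$; $M\succeq0$ means $M$ symmetric positive semidefinite; $\mathbf 0_n$ is the zero $n\times n$ matrix. $(P)$: minimize $\langle Q_0,xx^T\rangle+c_0^Tx$ over $x\in\mathbb{R}^n$ subject to $\langle Q_r,xx^T\rangle+c_r^Tx\le b_r$ ($r=1,\dots,m$) and $\ell_i\le x_i\le u_i$ ($i=1,\dots,n$). The feasible domain of $(P)$ is assumed non-empty. McCormick functions, for $1\le i\le j\le n$: $h^1_{ij}(x,Y)=Y_{ij}-u_jx_i-\ell_ix_j+u_j\ell_i$, $h^2_{ij}(x,Y)=Y_{ij}-u_ix_j-\ell_jx_i+u_i\ell_j$, $h^3_{ij}(x,Y)=-Y_{ij}+u_jx_i+u_ix_j-u_iu_j$, $h^4_{ij}(x,Y)=-Y_{ij}+\ell_jx_i+\ell_ix_j-\ell_i\ell_j$. General triangle functions $h^{'t}_{ijk}(x,Y)$, for $1\le i<j<k\le n$: $t=1$: $(\ell_k -u_k)Y_{ij} + (\ell_j - u_j)Y_{ik} - u_i Y_{jk}+ u_iu_kx_j + (u_ju_k - \ell_j\ell_k)x_i + u_iu_jx_k - u_iu_ju_k$ $t=2$: $(\ell_k -u_k)Y_{ij} - u_jY_{ik}+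 ( \ell_i -u_i)Y_{jk} + (u_iu_k - \ell_i\ell_k)x_j + u_ju_kx_i + u_iu_jx_k - u_iu_ju_k$ $t=3$: $- u_kY_{ij} + (\ell_j - u_j)Y_{ik}+ ( \ell_i -u_i)Y_{jk} + u_iu_kx_j + u_ju_kx_i + ( u_iu_j - \ell_i\ell_j)x_k - u_iu_ju_k$ $t=4$: $(u_j - \ell_j) Y_{ik} + (\ell_k - u_k) Y_{ij} + u_iY_{jk}+ (\ell_ju_k -u_j\ell_k)x_i - u_i\ell_kx_j - u_iu_jx_k + u_iu_j\ell_k$ $t=5$: $u_j Y_{ik} + (\ell_k - u_k) Y_{ij} + (u_i-\ell_i)Y_{jk} -u_j\ell_kx_i + (\ell_iu_k - u_i\ell_k)x_j - u_iu_jx_k + u_iu_j\ell_k$ $t=6$: $(u_k - \ell_k) Y_{ij} + u_iY_{jk} + (\ell_j - u_j) Y_{ik} -u_iu_kx_j +(u_j\ell_k - \ell_ju_k)x_i - u_i\ell_jx_k + u_i\ell_ju_k$ $t=7$: $u_kY_{ij} + (u_i - \ell_i) Y_{jk} + (\ell_j - u_j) Y_{ik} -u_iu_kx_j - \ell_ju_kx_i +(\ell_iu_j - u_i\ell_j)x_k + u_i\ell_ju_k$ $t=8$: $(u_k - \ell_k)Y_{ij} + (\ell_i - u_i) Y_{jk} + u_jY_{ik} +(u_i\ell_k - \ell_iu_k)x_j - u_ju_kx_i - \ell_iu_jx_k + \ell_iu_ju_k$ $t=9$: $u_kY_{ij} + (\ell_i - u_i) Y_{jk} + (u_j - \ell_j)Y_{ik}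 - \ell_iu_kx_j - u_ju_kx_i + (u_i\ell_j - \ell_iu_j) x_k + \ell_iu_ju_k$ $t=10$: $- u_i Y_{jk} + (u_j - \ell_j)Y_{ik} + (u_k - \ell_k) Y_{ij} + u_i\ell_kx_j + (\ell_j\ell_k - u_ju_k)x_i + u_i\ell_jx_k - u_i\ell_j\ell_k$ $t=11$: $(u_i - \ell_i)Y_{jk} - u_jY_{ik} + (u_k -\ell_k) Y_{ij} + (\ell_i\ell_k - u_iu_k)x_j + u_j\ell_kx_i + \ell_iu_jx_k - \ell_iu_j\ell_k$ $t=12$: $- u_kY_{ij} + (u_i - \ell_i)Y_{jk} + (u_j - \ell_j)Y_{ik} + \ell_iu_kx_j + \ell_ju_kx_i + (\ell_i\ell_j - u_iu_j)x_k - \ell_i\ell_ju_k$ For symmetric $X$, write $h^t_{ij}(x,X)=\langle M^t_{ij},X\rangle+(v^t_{ij})^Tx+l^t_{ij}$ and $h^{'t}_{ijk}(x,X)=\langle M^{'t}_{ijk},X\rangle+(v^{'t}_{ijk})^Tx+l^{'t}_{ijk}$, with $M^t_{ij},M^{'t}_{ijk}$ symmetric $n\times n$ matrices, $v^t_{ij},v^{'t}_{ijk}\in\mathbb{R}^n$ and $l^t_{ij},l^{'t}_{ijk}\in\mathbb{R}$. $(P'_{S_0,\ldots,S_m})$, for $S_0,\dots,S_m\succeq0$ of size $n\times n$: minimize $\langle S_0,xx^T\rangle+c_0^Tx+\langle Q_0-S_0,Y\rangle$ over $x\in\mathbb{R}^n$ and $Y\in\mathbb{R}^{n\times n}$ subject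 to $\ell_i\le x_i\le u_i$ for all $i$; $Y_{ji}=Y_{ij}$ for $i<j$; $\langle S_r,xx^T\rangle+c_r^Tx+\langle Q_r-S_r,Y\rangle\le b_r$ for $r=1,\dots,m$; $h^t_{ij}(x,Y)\le0$ for all $1\le i\le j\le n$, $t=1,\dots,4$; $h^{'t}_{ijk}(x,Y)\le0$ for all $i<j<k$, $t=1,\dots,12$. $(SDP)$: minimize $\langle Q_0,X\rangle+c_0^Tx$ over $x\in\mathbb{R}^n$ and symmetric $X\in\mathbb{R}^{n\times n}$ subject to $\langle Q_r,X\rangle+c_r^Tx\le b_r$ ($r=1,\dots,m$); $X_{ii}-u_ix_i-\ell_ix_i+u_i\ell_i\le0$, $-X_{ii}+2u_ix_i-u_i^2\le0$, $-X_{ii}+2\ell_ix_i-\ell_i^2\le0$ ($i=1,\dots,n$); $h^t_{ij}(x,X)\le0$ for all $1\le i<j\le n$, $t=1,\dots,4$; $h^{'t}_{ijk}(x,X)\le0$ for all $i<j<k$, $t=1,\dots,12$; $\begin{pmatrix} 1 & x^T \\ x & X \end{pmatrix}\succeq0$. Dual $(D)$ of $(SDP)$: over nonnegative $\alpha_r$, $\varphi^1_i,\varphi^2_i,\varphi^3_i$, $\phi^t_{ij}$ ($i<j$), $\delta^t_{ijk}$ and real $\rho$, maximize $$-\sum_r\alpha_rb_r+\sum_{i<j}\sum_{t=1}^4\phi^t_{ij}l^t_{ij}+\sum_{i<j<k}\sum_{t=1}^{12}\delta^t_{ijk}l^{'t}_{ijk}+\sum_i(u_i\ell_i\varphi^1_i-u_i^2\varphi^2_i-\ell_i^2\varphi^3_i)-\rho$$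 subject to $\begin{pmatrix} \rho & \frac12 d^T \\ \frac12 d & S \end{pmatrix}\succeq0$, where $S=Q_0+\sum_r\alpha_rQ_r+\sum_{i<j}\sum_t\phi^t_{ij}M^t_{ij}+\mathrm{diag}(\varphi^1-\varphi^2-\varphi^3)+\sum_{i<j<k}\sum_t\delta^t_{ijk}M^{'t}_{ijk}$ and $d=c_0+\sum_r\alpha_rc_r+\sum_{i<j}\sum_t\phi^t_{ij}v^t_{ij}+\sum_{i<j<k}\sum_t\delta^t_{ijk}v^{'t}_{ijk}+w$ with $w_i=-(u_i+\ell_i)\varphi^1_i+2u_i\varphi^2_i+2\ell_i\varphi^3_i$. "Optimal dual variables of $(SDP)$" means the components $(\alpha^*,\varphi^{1*},\varphi^{2*},\varphi^{3*},\phi^*,\delta^* )$ of an optimal solution (with some $\rho^*$) of $(D)$ whose objective value equals the optimal value of $(SDP)$. *)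

theory Defs
  imports "HOL-Analysis.Analysis"
begin

text \<open>
  The index set \<open>{1..n}\<close> is an arbitrary finite linearly ordered type \<open>'n\<close>; the order is needed
  for the index ranges \<open>i < j\<close> and \<open>i < j < k\<close>. Constraints are numbered by natural numbers
  \<open>1..m\<close>, which allows \<open>m = 0\<close>; index \<open>0\<close> of \<open>Q\<close>, \<open>c\<close> and \<open>S\<close> refers to the objective.
  The matrix inner product \<open>\<langle>A, B\<rangle>\<close> is the library's \<open>A \<bullet> B\<close> on nested vectors.
\<close>

type_synonym 'n rvec = "real ^ 'n"
type_synonym 'n rmat = "real ^ 'n ^ 'n"

section \<open>Matrices\<close>

definition symmetric_mat :: "real ^ 'n ^ 'n \<Rightarrow> bool" where
  "symmetric_mat A \<longleftrightarrow> transpose A = A"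

definition psd :: "real ^ 'n ^ 'n \<Rightarrow> bool" where
  "psd A \<longleftrightarrow> symmetric_mat A \<and> (\<forall>x. 0 \<le> x \<bullet> (A *v x))"

definition diag_mat :: "real ^ 'n \<Rightarrow> real ^ 'n ^ 'n" where
  "diag_mat d = (\<chi> i j. if i = j then d $ i else 0)"

definition self_outer :: "real ^ 'n \<Rightarrow> real ^ 'n ^ 'n" where
  "self_outer x = (\<chi> i j. x $ i * x $ j)"

text \<open>The block matrix with rows \<open>(a, x\<^sup>T)\<close> and \<open>(x, A)\<close>; \<open>None\<close> indexes the extra row and column.\<close>

definition bordered :: "real \<Rightarrow> real ^ 'n \<Rightarrow> real ^ 'n ^ 'n \<Rightarrow> real ^ 'n option ^ 'n option" where
  "bordered a x A = (\<chi> p q.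
     case p of
       None \<Rightarrow> (case q of None \<Rightarrow> a | Some j \<Rightarrow> x $ j)
     | Some i \<Rightarrow> (case q of None \<Rightarrow> x $ i | Some j \<Rightarrow> A $ i $ j))"

section \<open>McCormick and triangle functions\<close>

definition mccormick ::
  "real ^ 'n \<Rightarrow> real ^ 'n \<Rightarrow> nat \<Rightarrow> 'n \<Rightarrow> 'n \<Rightarrow> real ^ 'n \<Rightarrow> real ^ 'n ^ 'n \<Rightarrow> real" where
  "mccormick l u t i j x Y =
    (if t = 1 then Y$i$j - u$j * x$i - l$i * x$j + u$j * l$i
     else if t = 2 then Y$i$j - u$i * x$j - l$j * x$i + u$i * l$j
     else if t = 3 then - Y$i$j + u$j * x$i + u$i * x$j - u$i * u$j
     else - Y$i$j + l$j * x$i + l$i * x$j - l$i * l$j)"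

definition triangle_fun ::
  "real ^ 'n \<Rightarrow> real ^ 'n \<Rightarrow> nat \<Rightarrow> 'n \<Rightarrow> 'n \<Rightarrow> 'n \<Rightarrow> real ^ 'n \<Rightarrow> real ^ 'n ^ 'n \<Rightarrow> real" where
  "triangle_fun l u t i j k x Y =
    (if t = 1 then
       (l$k - u$k) * Y$i$j + (l$j - u$j) * Y$i$k - u$i * Y$j$k
       + u$i * u$k * x$j + (u$j * u$k - l$j * l$k) * x$i + u$i * u$j * x$k
       - u$i * u$j * u$k
     else if t = 2 then
       (l$k - u$k) * Y$i$j - u$j * Y$i$k + (l$i - u$i) * Y$j$k
       + (u$i * u$k - l$i * l$k) * x$j + u$j * u$k * x$i + u$i * u$j * x$k
       - u$i * u$j * u$k
     else if t = 3 then
       - u$k * Y$i$j + (l$j - u$j) * Y$i$k + (l$i - u$i) * Y$j$k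
       + u$i * u$k * x$j + u$j * u$k * x$i + (u$i * u$j - l$i * l$j) * x$k
       - u$i * u$j * u$k
     else if t = 4 then
       (u$j - l$j) * Y$i$k + (l$k - u$k) * Y$i$j + u$i * Y$j$k
       + (l$j * u$k - u$j * l$k) * x$i - u$i * l$k * x$j - u$i * u$j * x$k
       + u$i * u$j * l$k
     else if t = 5 then
       u$j * Y$i$k + (l$k - u$k) * Y$i$j + (u$i - l$i) * Y$j$k
       - u$j * l$k * x$i + (l$i * u$k - u$i * l$k) * x$j - u$i * u$j * x$k
       + u$i * u$j * l$k
     else if t = 6 then
       (u$k - l$k) * Y$i$j + u$i * Y$j$k + (l$j - u$j) * Y$i$k
       - u$i * u$k * x$j + (u$j * l$k - l$j * u$k) * x$i - u$i * l$j * x$k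
       + u$i * l$j * u$k
     else if t = 7 then
       u$k * Y$i$j + (u$i - l$i) * Y$j$k + (l$j - u$j) * Y$i$k
       - u$i * u$k * x$j - l$j * u$k * x$i + (l$i * u$j - u$i * l$j) * x$k
       + u$i * l$j * u$k
     else if t = 8 then
       (u$k - l$k) * Y$i$j + (l$i - u$i) * Y$j$k + u$j * Y$i$k
       + (u$i * l$k - l$i * u$k) * x$j - u$j * u$k * x$i - l$i * u$j * x$k
       + l$i * u$j * u$k
     else if t = 9 then
       u$k * Y$i$j + (l$i - u$i) * Y$j$k + (u$j - l$j) * Y$i$k
       - l$i * u$k * x$j - u$j * u$k * x$i + (u$i * l$j - l$i * u$j) * x$k
       + l$i * u$j * u$k
     else if t = 10 then
       - u$i * Y$j$k + (u$j - l$j) * Y$i$k + (u$k - l$k) * Y$i$j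
       + u$i * l$k * x$j + (l$j * l$k - u$j * u$k) * x$i + u$i * l$j * x$k
       - u$i * l$j * l$k
     else if t = 11 then
       (u$i - l$i) * Y$j$k - u$j * Y$i$k + (u$k - l$k) * Y$i$j
       + (l$i * l$k - u$i * u$k) * x$j + u$j * l$k * x$i + l$i * u$j * x$k
       - l$i * u$j * l$k
     else
       - u$k * Y$i$j + (u$i - l$i) * Y$j$k + (u$j - l$j) * Y$i$k
       + l$i * u$k * x$j + l$j * u$k * x$i + (l$i * l$j - u$i * u$j) * x$k
       - l$i * l$j * u$k)"

section \<open>Coefficients of affine functions of a vector and a symmetric matrix\<close>

definition has_coeffs ::
  "(real ^ 'n \<Rightarrow> real ^ 'n ^ 'n \<Rightarrow> real) \<Rightarrow> (real ^ 'n ^ 'n) \<times> (real ^ 'n) \<times> real \<Rightarrow> bool" where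
  "has_coeffs h = (\<lambda>(M, v, a). symmetric_mat M \<and>
     (\<forall>x X. symmetric_mat X \<longrightarrow> h x X = M \<bullet> X + v \<bullet> x + a))"

definition coeffs_of ::
  "(real ^ 'n \<Rightarrow> real ^ 'n ^ 'n \<Rightarrow> real) \<Rightarrow> (real ^ 'n ^ 'n) \<times> (real ^ 'n) \<times> real" where
  "coeffs_of h = (THE p. has_coeffs h p)"

definition mat_coeff :: "(real ^ 'n \<Rightarrow> real ^ 'n ^ 'n \<Rightarrow> real) \<Rightarrow> real ^ 'n ^ 'n" where
  "mat_coeff h = fst (coeffs_of h)"

definition vec_coeff :: "(real ^ 'n \<Rightarrow> real ^ 'n ^ 'n \<Rightarrow> real) \<Rightarrow> real ^ 'n" where
  "vec_coeff h = fst (snd (coeffs_of h))"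

definition const_coeff :: "(real ^ 'n \<Rightarrow> real ^ 'n ^ 'n \<Rightarrow> real) \<Rightarrow> real" where
  "const_coeff h = snd (snd (coeffs_of h))"

text \<open>
  The coefficients are unique, and they exist for all McCormick and triangle functions, so the
  definite descriptions above are well-defined where they are used.
\<close>

lemma symmetric_mat_iff: "symmetric_mat A \<longleftrightarrow> (\<forall>i j. A $ i $ j = A $ j $ i)"
  unfolding symmetric_mat_def transpose_def vec_eq_iff by auto

lemma has_coeffs_unique:
  assumes "has_coeffs h p" "has_coeffs h p'"
  shows "p = p'"
proof -
  obtain M v a where p: "p = (M, v, a)" by (cases p)
  obtain M' v' a' where p': "p' = (M', v', a')" by (cases p')
  have sM: "symmetric_mat M" "symmetric_mat M'"
    using assms by (auto simp: has_coeffs_def p p')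
  have eq: "M \<bullet> X + v \<bullet> x + a = M' \<bullet> X + v' \<bullet> x + a'" if "symmetric_mat X" for x X
  proof -
    have "h x X = M \<bullet> X + v \<bullet> x + a" "h x X = M' \<bullet> X + v' \<bullet> x + a'"
      using assms that by (auto simp: has_coeffs_def p p')
    then show ?thesis by simp
  qed
  have s0: "symmetric_mat 0" by (simp add: symmetric_mat_iff)
  have sd: "symmetric_mat (M - M')"
    using sM by (simp add: symmetric_mat_iff)
  have a: "a = a'" using eq[OF s0, of 0] by simp
  have "v \<bullet> x = v' \<bullet> x" for x using eq[OF s0, of x] a by simp
  then have v: "v = v'" using vector_eq_rdot by blast
  have "(M - M') \<bullet> (M - M') = 0" using eq[OF sd, of 0] a by (simp add: inner_diff_left)
  then have "M = M'" by simp
  then show ?thesis using a v p p' by simp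
qed

lemma has_coeffs_coord:
  fixes i j :: "'n::finite"
  shows "\<exists>p. has_coeffs (\<lambda>x Y. Y $ i $ j) p"
proof -
  define M :: "real ^ 'n ^ 'n"
    where "M = (1/2) *\<^sub>R (axis i (axis j 1) + axis j (axis i 1))"
  have ax: "(axis a (axis b 1) :: real ^ 'n ^ 'n) $ p $ q = (if p = a \<and> q = b then 1 else 0)"
    for a b p q by (simp add: axis_def)
  have "M $ p $ q = M $ q $ p" for p q
    unfolding M_def vector_scaleR_component vector_add_component ax
    by (simp only: conj_commute add.commute)
  then have M: "symmetric_mat M" by (simp add: symmetric_mat_iff)
  have "X $ i $ j = M \<bullet> X" if "symmetric_mat X" for X
  proof -
    have "X $ j $ i = X $ i $ j" using that unfolding symmetric_mat_iff by (elim allE)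
    moreover have "M \<bullet> X = (1/2) * (X $ i $ j + X $ j $ i)"
      unfolding M_def inner_scaleR_left inner_add_left inner_axis' by simp
    ultimately show ?thesis by simp
  qed
  with M have "has_coeffs (\<lambda>x Y. Y $ i $ j) (M, 0, 0)"
    by (simp add: has_coeffs_def)
  then show ?thesis ..
qed

lemma has_coeffs_entry: "\<exists>p. has_coeffs (\<lambda>x Y. x $ i) p"
proof -
  have "has_coeffs (\<lambda>x Y. x $ i) (0, axis i 1, 0)"
    by (simp add: has_coeffs_def symmetric_mat_iff inner_axis')
  then show ?thesis ..
qed

lemma has_coeffs_const: "\<exists>p. has_coeffs (\<lambda>x Y. a) p"
proof -
  have "has_coeffs (\<lambda>x Y. a) (0, 0, a)"
    by (simp add: has_coeffs_def symmetric_mat_iff)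
  then show ?thesis ..
qed

lemma has_coeffs_scale:
  assumes "\<exists>p. has_coeffs h p"
  shows "\<exists>p. has_coeffs (\<lambda>x Y. a * h x Y) p"
proof -
  obtain M v b where 1: "has_coeffs h (M, v, b)" using assms by auto
  have "symmetric_mat (a *\<^sub>R M)" using 1 by (simp add: has_coeffs_def symmetric_mat_iff)
  with 1 have "has_coeffs (\<lambda>x Y. a * h x Y) (a *\<^sub>R M, a *\<^sub>R v, a * b)"
    by (simp add: has_coeffs_def distrib_left)
  then show ?thesis ..
qed

lemma has_coeffs_add:
  assumes "\<exists>p. has_coeffs h p" "\<exists>p. has_coeffs h' p"
  shows "\<exists>p. has_coeffs (\<lambda>x Y. h x Y + h' x Y) p"
proof -
  obtain M v b where 1: "has_coeffs h (M, v, b)" using assms by auto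
  obtain M' v' b' where 2: "has_coeffs h' (M', v', b')" using assms by auto
  have "symmetric_mat (M + M')" using 1 2 by (simp add: has_coeffs_def symmetric_mat_iff)
  with 1 2 have "has_coeffs (\<lambda>x Y. h x Y + h' x Y) (M + M', v + v', b + b')"
    by (simp add: has_coeffs_def inner_add_left)
  then show ?thesis ..
qed

lemma has_coeffs_minus:
  assumes "\<exists>p. has_coeffs h p"
  shows "\<exists>p. has_coeffs (\<lambda>x Y. - h x Y) p"
  using has_coeffs_scale[OF assms, of "-1"] by simp

lemma has_coeffs_diff:
  assumes "\<exists>p. has_coeffs h p" "\<exists>p. has_coeffs h' p"
  shows "\<exists>p. has_coeffs (\<lambda>x Y. h x Y - h' x Y) p"
  using has_coeffs_add[OF assms(1) has_coeffs_minus[OF assms(2)]] by simp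

lemma has_coeffs_if:
  assumes "\<exists>p. has_coeffs h p" "\<exists>p. has_coeffs h' p"
  shows "\<exists>p. has_coeffs (\<lambda>x Y. if B then h x Y else h' x Y) p"
  using assms by (cases B) simp_all

lemmas has_coeffs_intros =
  has_coeffs_if has_coeffs_const has_coeffs_coord has_coeffs_entry
  has_coeffs_add has_coeffs_diff has_coeffs_scale has_coeffs_minus

lemma has_coeffs_coeffs_of:
  assumes "\<exists>p. has_coeffs h p"
  shows "has_coeffs h (mat_coeff h, vec_coeff h, const_coeff h)"
proof -
  obtain p where p: "has_coeffs h p" using assms ..
  have "has_coeffs h (coeffs_of h)"
    unfolding coeffs_of_def using p by (rule theI) (rule has_coeffs_unique[OF _ p])
  then show ?thesis by (simp add: mat_coeff_def vec_coeff_def const_coeff_def)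
qed

lemma mccormick_coeffs:
  "has_coeffs (mccormick l u t i j)
     (mat_coeff (mccormick l u t i j), vec_coeff (mccormick l u t i j),
      const_coeff (mccormick l u t i j))"
proof (rule has_coeffs_coeffs_of)
  show "\<exists>p. has_coeffs (mccormick l u t i j) p"
    unfolding mccormick_def[abs_def] by (intro has_coeffs_intros)
qed

lemma triangle_fun_coeffs:
  "has_coeffs (triangle_fun l u t i j k)
     (mat_coeff (triangle_fun l u t i j k), vec_coeff (triangle_fun l u t i j k),
      const_coeff (triangle_fun l u t i j k))"
proof (rule has_coeffs_coeffs_of)
  show "\<exists>p. has_coeffs (triangle_fun l u t i j k) p"
    unfolding triangle_fun_def[abs_def]
    by (intro has_coeffs_intros)
qed

section \<open>The optimization problems and their optimal values\<close>

text \<open>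
  Optimal values are infima in the extended reals: \<open>\<infinity>\<close> for an infeasible minimization problem,
  \<open>-\<infinity>\<close> for an unbounded one.
\<close>

definition feasible_P ::
  "nat \<Rightarrow> (nat \<Rightarrow> 'n::finite rmat) \<Rightarrow> (nat \<Rightarrow> 'n rvec) \<Rightarrow> (nat \<Rightarrow> real) \<Rightarrow>
   'n rvec \<Rightarrow> 'n rvec \<Rightarrow> 'n rvec set" where
  "feasible_P m Q c b l u =
    {x. (\<forall>r\<in>{1..m}. Q r \<bullet> self_outer x + c r \<bullet> x \<le> b r) \<and>
        (\<forall>i. l$i \<le> x$i \<and> x$i \<le> u$i)}"

definition feasible_P' ::
  "nat \<Rightarrow> (nat \<Rightarrow> 'n::{finite,linorder} rmat) \<Rightarrow> (nat \<Rightarrow> 'n rvec) \<Rightarrow> (nat \<Rightarrow> real) \<Rightarrow>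
   'n rvec \<Rightarrow> 'n rvec \<Rightarrow> (nat \<Rightarrow> 'n rmat) \<Rightarrow>
   ('n rvec \<times> 'n rmat) set" where
  "feasible_P' m Q c b l u S =
    {(x, Y).
      (\<forall>i. l$i \<le> x$i \<and> x$i \<le> u$i) \<and>
      (\<forall>i j. i < j \<longrightarrow> Y$j$i = Y$i$j) \<and>
      (\<forall>r\<in>{1..m}. S r \<bullet> self_outer x + c r \<bullet> x + (Q r - S r) \<bullet> Y \<le> b r) \<and>
      (\<forall>i j. i \<le> j \<longrightarrow> (\<forall>t\<in>{1..4}. mccormick l u t i j x Y \<le> 0)) \<and>
      (\<forall>i j k. i < j \<and> j < k \<longrightarrow> (\<forall>t\<in>{1..12}. triangle_fun l u t i j k x Y \<le> 0))}"

definition value_P' ::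
  "nat \<Rightarrow> (nat \<Rightarrow> 'n::{finite,linorder} rmat) \<Rightarrow> (nat \<Rightarrow> 'n rvec) \<Rightarrow> (nat \<Rightarrow> real) \<Rightarrow>
   'n rvec \<Rightarrow> 'n rvec \<Rightarrow> (nat \<Rightarrow> 'n rmat) \<Rightarrow> ereal" where
  "value_P' m Q c b l u S =
    (INF (x, Y) \<in> feasible_P' m Q c b l u S.
       ereal (S 0 \<bullet> self_outer x + c 0 \<bullet> x + (Q 0 - S 0) \<bullet> Y))"

definition optimal_OPT ::
  "nat \<Rightarrow> (nat \<Rightarrow> 'n::{finite,linorder} rmat) \<Rightarrow> (nat \<Rightarrow> 'n rvec) \<Rightarrow> (nat \<Rightarrow> real) \<Rightarrow>
   'n rvec \<Rightarrow> 'n rvec \<Rightarrow> (nat \<Rightarrow> 'n rmat) \<Rightarrow> bool" where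
  "optimal_OPT m Q c b l u S \<longleftrightarrow>
    (\<forall>r\<le>m. psd (S r)) \<and>
    (\<forall>T. (\<forall>r\<le>m. psd (T r)) \<longrightarrow> value_P' m Q c b l u T \<le> value_P' m Q c b l u S)"

definition feasible_SDP ::
  "nat \<Rightarrow> (nat \<Rightarrow> 'n::{finite,linorder} rmat) \<Rightarrow> (nat \<Rightarrow> 'n rvec) \<Rightarrow> (nat \<Rightarrow> real) \<Rightarrow>
   'n rvec \<Rightarrow> 'n rvec \<Rightarrow> ('n rvec \<times> 'n rmat) set" where
  "feasible_SDP m Q c b l u =
    {(x, X).
      symmetric_mat X \<and>
      (\<forall>r\<in>{1..m}. Q r \<bullet> X + c r \<bullet> x \<le> b r) \<and>
      (\<forall>i. X$i$i - u$i * x$i - l$i * x$i + u$i * l$i \<le> 0 \<and>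
           - X$i$i + 2 * u$i * x$i - (u$i)\<^sup>2 \<le> 0 \<and>
           - X$i$i + 2 * l$i * x$i - (l$i)\<^sup>2 \<le> 0) \<and>
      (\<forall>i j. i < j \<longrightarrow> (\<forall>t\<in>{1..4}. mccormick l u t i j x X \<le> 0)) \<and>
      (\<forall>i j k. i < j \<and> j < k \<longrightarrow> (\<forall>t\<in>{1..12}. triangle_fun l u t i j k x X \<le> 0)) \<and>
      psd (bordered 1 x X)}"

definition value_SDP ::
  "nat \<Rightarrow> (nat \<Rightarrow> 'n::{finite,linorder} rmat) \<Rightarrow> (nat \<Rightarrow> 'n rvec) \<Rightarrow> (nat \<Rightarrow> real) \<Rightarrow>
   'n rvec \<Rightarrow> 'n rvec \<Rightarrow> ereal" where
  "value_SDP m Q c b l u =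
    (INF (x, X) \<in> feasible_SDP m Q c b l u. ereal (Q 0 \<bullet> X + c 0 \<bullet> x))"

section \<open>The dual of the semidefinite program\<close>

definition pairs :: "('n::{finite,linorder} \<times> 'n) set" where
  "pairs = {(i, j). i < j}"

definition triples :: "('n::{finite,linorder} \<times> 'n \<times> 'n) set" where
  "triples = {(i, j, k). i < j \<and> j < k}"

definition Phi_mat ::
  "'n::{finite,linorder} rvec \<Rightarrow> 'n rvec \<Rightarrow> 'n rvec \<Rightarrow> 'n rvec \<Rightarrow> 'n rvec \<Rightarrow>
   (nat \<Rightarrow> 'n \<Rightarrow> 'n \<Rightarrow> real) \<Rightarrow> 'n rmat" where
  "Phi_mat l u \<phi>1 \<phi>2 \<phi>3 \<phi> =
    (\<Sum>(i, j)\<in>pairs. \<Sum>t=1..4. \<phi> t i j *\<^sub>R mat_coeff (mccormick l u t i j)) +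
    diag_mat (\<phi>1 - \<phi>2 - \<phi>3)"

definition Delta_mat ::
  "'n::{finite,linorder} rvec \<Rightarrow> 'n rvec \<Rightarrow>
   (nat \<Rightarrow> 'n \<Rightarrow> 'n \<Rightarrow> 'n \<Rightarrow> real) \<Rightarrow> 'n rmat" where
  "Delta_mat l u \<delta> =
    (\<Sum>(i, j, k)\<in>triples. \<Sum>t=1..12. \<delta> t i j k *\<^sub>R mat_coeff (triangle_fun l u t i j k))"

definition dual_mat ::
  "nat \<Rightarrow> (nat \<Rightarrow> 'n::{finite,linorder} rmat) \<Rightarrow> 'n rvec \<Rightarrow> 'n rvec \<Rightarrow>
   (nat \<Rightarrow> real) \<Rightarrow> 'n rvec \<Rightarrow> 'n rvec \<Rightarrow> 'n rvec \<Rightarrow>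
   (nat \<Rightarrow> 'n \<Rightarrow> 'n \<Rightarrow> real) \<Rightarrow> (nat \<Rightarrow> 'n \<Rightarrow> 'n \<Rightarrow> 'n \<Rightarrow> real) \<Rightarrow>
   'n rmat" where
  "dual_mat m Q l u \<alpha> \<phi>1 \<phi>2 \<phi>3 \<phi> \<delta> =
    Q 0 + (\<Sum>r=1..m. \<alpha> r *\<^sub>R Q r) + Phi_mat l u \<phi>1 \<phi>2 \<phi>3 \<phi> + Delta_mat l u \<delta>"

definition dual_vec ::
  "nat \<Rightarrow> (nat \<Rightarrow> 'n::{finite,linorder} rvec) \<Rightarrow> 'n rvec \<Rightarrow> 'n rvec \<Rightarrow>
   (nat \<Rightarrow> real) \<Rightarrow> 'n rvec \<Rightarrow> 'n rvec \<Rightarrow> 'n rvec \<Rightarrow>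
   (nat \<Rightarrow> 'n \<Rightarrow> 'n \<Rightarrow> real) \<Rightarrow> (nat \<Rightarrow> 'n \<Rightarrow> 'n \<Rightarrow> 'n \<Rightarrow> real) \<Rightarrow>
   'n rvec" where
  "dual_vec m c l u \<alpha> \<phi>1 \<phi>2 \<phi>3 \<phi> \<delta> =
    c 0 + (\<Sum>r=1..m. \<alpha> r *\<^sub>R c r) +
    (\<Sum>(i, j)\<in>pairs. \<Sum>t=1..4. \<phi> t i j *\<^sub>R vec_coeff (mccormick l u t i j)) +
    (\<Sum>(i, j, k)\<in>triples. \<Sum>t=1..12. \<delta> t i j k *\<^sub>R vec_coeff (triangle_fun l u t i j k)) +
    (\<chi> i. - (u$i + l$i) * \<phi>1$i + 2 * u$i * \<phi>2$i + 2 * l$i * \<phi>3$i)"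

definition dual_obj ::
  "nat \<Rightarrow> (nat \<Rightarrow> real) \<Rightarrow> 'n::{finite,linorder} rvec \<Rightarrow> 'n rvec \<Rightarrow>
   (nat \<Rightarrow> real) \<Rightarrow> 'n rvec \<Rightarrow> 'n rvec \<Rightarrow> 'n rvec \<Rightarrow>
   (nat \<Rightarrow> 'n \<Rightarrow> 'n \<Rightarrow> real) \<Rightarrow> (nat \<Rightarrow> 'n \<Rightarrow> 'n \<Rightarrow> 'n \<Rightarrow> real) \<Rightarrow>
   real \<Rightarrow> real" where
  "dual_obj m b l u \<alpha> \<phi>1 \<phi>2 \<phi>3 \<phi> \<delta> \<rho> =
    - (\<Sum>r=1..m. \<alpha> r * b r) +
    (\<Sum>(i, j)\<in>pairs. \<Sum>t=1..4. \<phi> t i j * const_coeff (mccormick l u t i j)) +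
    (\<Sum>(i, j, k)\<in>triples. \<Sum>t=1..12. \<delta> t i j k * const_coeff (triangle_fun l u t i j k)) +
    (\<Sum>i\<in>UNIV. u$i * l$i * \<phi>1$i - (u$i)\<^sup>2 * \<phi>2$i - (l$i)\<^sup>2 * \<phi>3$i) - \<rho>"

definition feasible_D ::
  "nat \<Rightarrow> (nat \<Rightarrow> 'n::{finite,linorder} rmat) \<Rightarrow> (nat \<Rightarrow> 'n rvec) \<Rightarrow> 'n rvec \<Rightarrow> 'n rvec \<Rightarrow>
   (nat \<Rightarrow> real) \<Rightarrow> 'n rvec \<Rightarrow> 'n rvec \<Rightarrow> 'n rvec \<Rightarrow>
   (nat \<Rightarrow> 'n \<Rightarrow> 'n \<Rightarrow> real) \<Rightarrow> (nat \<Rightarrow> 'n \<Rightarrow> 'n \<Rightarrow> 'n \<Rightarrow> real) \<Rightarrow>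
   real \<Rightarrow> bool" where
  "feasible_D m Q c l u \<alpha> \<phi>1 \<phi>2 \<phi>3 \<phi> \<delta> \<rho> \<longleftrightarrow>
    (\<forall>r\<in>{1..m}. 0 \<le> \<alpha> r) \<and>
    (\<forall>i. 0 \<le> \<phi>1$i \<and> 0 \<le> \<phi>2$i \<and> 0 \<le> \<phi>3$i) \<and>
    (\<forall>i j. i < j \<longrightarrow> (\<forall>t\<in>{1..4}. 0 \<le> \<phi> t i j)) \<and>
    (\<forall>i j k. i < j \<and> j < k \<longrightarrow> (\<forall>t\<in>{1..12}. 0 \<le> \<delta> t i j k)) \<and>
    psd (bordered \<rho> ((1/2) *\<^sub>R dual_vec m c l u \<alpha> \<phi>1 \<phi>2 \<phi>3 \<phi> \<delta>)
                    (dual_mat m Q l u \<alpha> \<phi>1 \<phi>2 \<phi>3 \<phi> \<delta>))"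

text \<open>
  Optimal dual variables: with some \<open>\<rho>\<close> they maximize the dual objective, and the duality gap is
  zero. The latter forces the optimal value of the semidefinite program to be finite.
\<close>

definition optimal_dual_vars ::
  "nat \<Rightarrow> (nat \<Rightarrow> 'n::{finite,linorder} rmat) \<Rightarrow> (nat \<Rightarrow> 'n rvec) \<Rightarrow> (nat \<Rightarrow> real) \<Rightarrow>
   'n rvec \<Rightarrow> 'n rvec \<Rightarrow>
   (nat \<Rightarrow> real) \<Rightarrow> 'n rvec \<Rightarrow> 'n rvec \<Rightarrow> 'n rvec \<Rightarrow>
   (nat \<Rightarrow> 'n \<Rightarrow> 'n \<Rightarrow> real) \<Rightarrow> (nat \<Rightarrow> 'n \<Rightarrow> 'n \<Rightarrow> 'n \<Rightarrow> real) \<Rightarrow> bool" where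
  "optimal_dual_vars m Q c b l u \<alpha> \<phi>1 \<phi>2 \<phi>3 \<phi> \<delta> \<longleftrightarrow>
    (\<exists>\<rho>. feasible_D m Q c l u \<alpha> \<phi>1 \<phi>2 \<phi>3 \<phi> \<delta> \<rho> \<and>
      (\<forall>\<alpha>' \<phi>1' \<phi>2' \<phi>3' \<phi>' \<delta>' \<rho>'. feasible_D m Q c l u \<alpha>' \<phi>1' \<phi>2' \<phi>3' \<phi>' \<delta>' \<rho>' \<longrightarrow>
         dual_obj m b l u \<alpha>' \<phi>1' \<phi>2' \<phi>3' \<phi>' \<delta>' \<rho>' \<le> dual_obj m b l u \<alpha> \<phi>1 \<phi>2 \<phi>3 \<phi> \<delta> \<rho>) \<and>
      ereal (dual_obj m b l u \<alpha> \<phi>1 \<phi>2 \<phi>3 \<phi> \<delta> \<rho>) = value_SDP m Q c b l u)"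

end

theory Submission
  imports Defs
begin

text \<open>
  The proof compares each \<open>v(P'\<^bsub>T\<^esub>)\<close> with the optimal value of the semidefinite program
  and shows that the matrices built from optimal dual variables attain the bound.

  \<^item> For every choice of positive semidefinite \<open>T\<close>, a feasible point \<open>(x, X)\<close> of the semidefinite
    program is feasible for \<open>P'\<^bsub>T\<^esub>\<close> with an objective that is no larger. Indeed
    \<open>\<langle>T\<^sub>r, xx\<^sup>T\<rangle> + \<langle>Q\<^sub>r - T\<^sub>r, X\<rangle> = \<langle>Q\<^sub>r, X\<rangle> - \<langle>T\<^sub>r, X - xx\<^sup>T\<rangle>\<close>, and the last product is nonnegative
    because \<open>X - xx\<^sup>T\<close> is the Schur complement of the bordered matrix and the inner product of two
    positive semidefinite matrices is nonnegative (\<open>psd_inner_nonneg\<close>). So \<open>v(P'\<^bsub>T\<^esub>)\<close> is at most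
    the value of the semidefinite program (\<open>value_P'_le_value_SDP\<close>).

  \<^item> For \<open>S\<^sub>0\<close> the dual matrix and \<open>S\<^sub>r = 0\<close> otherwise, all constraints of \<open>P'\<^bsub>S\<^esub>\<close> that are
    dualized are linear in \<open>(x, Y)\<close>. Adding them to the objective with the dual variables as weights
    cancels \<open>Y\<close> altogether and leaves \<open>\<langle>S\<^sub>0, xx\<^sup>T\<rangle> + d\<^sup>Tx\<close> plus a constant. Up to that constant and
    \<open>\<rho>\<close>, this is the quadratic form of the dual's bordered matrix at \<open>(1, x)\<close>, hence nonnegative.
    So \<open>v(P'\<^bsub>S\<^esub>)\<close> is at least the dual objective (\<open>dual_obj_le_value_P'\<close>).

  Since the dual variables close the duality gap, the two bounds coincide.
\<close>

section \<open>Positive semidefinite matrices\<close>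

lemma psdD:
  assumes "psd A"
  shows "0 \<le> z \<bullet> (A *v z)"
  using assms by (simp add: psd_def)

lemma psd_sym:
  assumes "psd A"
  shows "A $ i $ j = A $ j $ i"
  using assms unfolding psd_def symmetric_mat_iff by blast

lemma psd_zero: "psd 0"
  by (simp add: psd_def symmetric_mat_iff)

lemma inner_self_outer: "A \<bullet> self_outer z = z \<bullet> (A *v z)"
  by (simp add: inner_vec_def self_outer_def matrix_vector_mult_def sum_distrib_left mult_ac)

lemma quadratic_form_add_axis:
  assumes "symmetric_mat A"
  shows "(z + s *\<^sub>R axis k 1) \<bullet> (A *v (z + s *\<^sub>R axis k 1))
    = z \<bullet> (A *v z) + 2 * s * (A $ k \<bullet> z) + s\<^sup>2 * A $ k $ k"
proof -
  have e: "axis k 1 \<bullet> (A *v w) = A $ k \<bullet> w" for w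
    by (simp add: inner_axis' matrix_vector_mul_component)
  have sym: "w \<bullet> (A *v axis k 1) = A $ k \<bullet> w" for w
    using assms e by (metis dot_lmul_matrix inner_commute symmetric_mat_def
        transpose_matrix_vector)
  have "A $ k \<bullet> axis k 1 = A $ k $ k"
    by (simp add: inner_axis)
  then show ?thesis
    by (simp add: matrix_vector_right_distrib matrix_vector_mult_scaleR inner_add_left
        inner_add_right sym e power2_eq_square algebra_simps)
qed

text \<open>
  This is the Cauchy-Schwarz inequality for the semi-inner product of \<open>A\<close>, applied to \<open>z\<close> and a unit
  vector. It controls a whole row of \<open>A\<close> by its diagonal entry.
\<close>

lemma psd_row_bound:
  assumes "psd A"
  shows "(A $ k \<bullet> z)\<^sup>2 \<le> A $ k $ k * (z \<bullet> (A *v z))"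
proof -
  let ?a = "A $ k \<bullet> z" and ?d = "A $ k $ k" and ?q = "z \<bullet> (A *v z)"
  have sym: "symmetric_mat A" using assms by (simp add: psd_def)
  have nonneg: "0 \<le> ?q + 2 * s * ?a + s\<^sup>2 * ?d" for s
    using psdD[OF assms, of "z + s *\<^sub>R axis k 1"] quadratic_form_add_axis[OF sym, of z s k]
    by simp
  have "0 \<le> ?d"
    using psdD[OF assms, of "0 + 1 *\<^sub>R axis k 1"] quadratic_form_add_axis[OF sym, of 0 1 k]
    by simp
  then consider "?d = 0" | "0 < ?d" by linarith
  then show ?thesis
  proof cases
    case 1
    have "?a = 0"
    proof (rule ccontr)
      assume "?a \<noteq> 0"
      with nonneg[of "- (?q + 1) / (2 * ?a)"] 1 show False
        by (simp add: field_simps)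
    qed
    with 1 show ?thesis by simp
  next
    case 2
    \<comment> \<open>the minimizer in \<open>s\<close>\<close>
    have "0 \<le> ?q - ?a\<^sup>2 / ?d"
      using nonneg[of "- ?a / ?d"] 2 by (simp add: field_simps power2_eq_square)
    with 2 show ?thesis by (simp add: field_simps)
  qed
qed

lemma psd_row_zero:
  assumes "psd A" "A $ k $ k = 0"
  shows "A $ k = 0"
  using psd_row_bound[OF assms(1), of k "A $ k"] assms(2) by simp

lemma psd_diag_nonneg:
  assumes "psd A"
  shows "0 \<le> A $ k $ k"
  using psdD[OF assms, of "axis k 1"]
  by (simp add: inner_axis' matrix_vector_mul_component inner_axis)

text \<open>
  Subtracting this rank-one matrix is one step of symmetric Gaussian elimination with pivot \<open>k\<close>.
\<close>

lemma psd_eliminate: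
  assumes "psd A" "0 < A $ k $ k"
  shows "psd (A - (1 / A $ k $ k) *\<^sub>R self_outer (A $ k))"
  unfolding psd_def
proof (intro conjI allI)
  show "symmetric_mat (A - (1 / A $ k $ k) *\<^sub>R self_outer (A $ k))"
    using psd_sym[OF assms(1)] by (simp add: symmetric_mat_iff self_outer_def mult.commute)
next
  fix z
  have "z \<bullet> ((A - (1 / A $ k $ k) *\<^sub>R self_outer (A $ k)) *v z)
      = z \<bullet> (A *v z) - (1 / A $ k $ k) * (self_outer (A $ k) \<bullet> self_outer z)"
    by (simp only: inner_self_outer[symmetric] inner_diff_left inner_scaleR_left)
  also have "self_outer (A $ k) \<bullet> self_outer z = (A $ k \<bullet> z)\<^sup>2"
    by (simp add: inner_vec_def self_outer_def power2_eq_square sum_product mult_ac)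
  moreover have "(1 / A $ k $ k) * (A $ k \<bullet> z)\<^sup>2 \<le> z \<bullet> (A *v z)"
    using psd_row_bound[OF assms(1), of k z] assms(2) by (simp add: field_simps)
  ultimately show "0 \<le> z \<bullet> ((A - (1 / A $ k $ k) *\<^sub>R self_outer (A $ k)) *v z)"
    by simp
qed

text \<open>
  Elimination writes \<open>A\<close> as a nonnegative combination of rank-one matrices \<open>aa\<^sup>T\<close>, and
  \<open>\<langle>aa\<^sup>T, B\<rangle> = a\<^sup>TBa\<close>. The induction is on the number of nonzero rows: each step clears the pivot
  row and, by symmetry, preserves the rows that are already zero.
\<close>

lemma psd_inner_nonneg:
  assumes "psd A" "psd B"
  shows "0 \<le> A \<bullet> B"
  using assms(1)
proof (induction "card {k. A $ k \<noteq> 0}" arbitrary: A rule: less_induct)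
  case less
  show ?case
  proof (cases "A = 0")
    case False
    then obtain k where k: "A $ k \<noteq> 0" by (auto simp: vec_eq_iff)
    define A' where "A' = A - (1 / A $ k $ k) *\<^sub>R self_outer (A $ k)"
    have pos: "0 < A $ k $ k"
      using k psd_row_zero[OF less.prems] psd_diag_nonneg[OF less.prems, of k]
      by (metis less_eq_real_def)
    have "A' $ k = 0"
      using pos by (simp add: A'_def self_outer_def vec_eq_iff)
    moreover have "A' $ i = 0" if "A $ i = 0" for i
      using that psd_sym[OF less.prems, of k i] by (simp add: A'_def self_outer_def vec_eq_iff)
    ultimately have "{i. A' $ i \<noteq> 0} \<subset> {i. A $ i \<noteq> 0}"
      using k by auto
    then have "card {i. A' $ i \<noteq> 0} < card {i. A $ i \<noteq> 0}"
      by (simp add: psubset_card_mono)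
    moreover have "psd A'"
      unfolding A'_def using less.prems pos by (rule psd_eliminate)
    ultimately have "0 \<le> A' \<bullet> B"
      using less.hyps by blast
    moreover have "0 \<le> self_outer (A $ k) \<bullet> B"
      using psdD[OF assms(2), of "A $ k"] by (simp add: inner_self_outer inner_commute)
    moreover have "A \<bullet> B = A' \<bullet> B + (1 / A $ k $ k) * (self_outer (A $ k) \<bullet> B)"
      by (simp add: A'_def inner_diff_left)
    ultimately show ?thesis using pos by simp
  qed simp
qed

section \<open>Bordered matrices\<close>

lemma quadratic_form_bordered:
  fixes t :: real and x z :: "real ^ 'n::finite"
  defines "w \<equiv> (\<chi> p. case p of None \<Rightarrow> t | Some i \<Rightarrow> z $ i)"
  shows "w \<bullet> (bordered a x A *v w) = a * t\<^sup>2 + 2 * t * (x \<bullet> z) + z \<bullet> (A *v z)"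
proof -
  have sum_option: "(\<Sum>p\<in>UNIV. f p) = f None + (\<Sum>i\<in>UNIV. f (Some i))"
    for f :: "'n option \<Rightarrow> real"
    by (simp add: UNIV_option_conv sum.reindex)
  show ?thesis
    by (simp add: w_def inner_vec_def matrix_vector_mult_def bordered_def sum_option
        sum_distrib_left sum.distrib power2_eq_square algebra_simps)
qed

lemma bordered_form_nonneg:
  assumes "psd (bordered a x A)"
  shows "0 \<le> a * t\<^sup>2 + 2 * t * (x \<bullet> z) + z \<bullet> (A *v z)"
  using psdD[OF assms, of "\<chi> p. case p of None \<Rightarrow> t | Some i \<Rightarrow> z $ i"]
  by (simp only: quadratic_form_bordered)

lemma psd_bordered_block:
  assumes "psd (bordered a x A)"
  shows "psd A"
  unfolding psd_def symmetric_mat_iff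
proof (intro conjI allI)
  show "A $ i $ j = A $ j $ i" for i j
    using psd_sym[OF assms, of "Some i" "Some j"] by (simp add: bordered_def)
  show "0 \<le> z \<bullet> (A *v z)" for z
    using bordered_form_nonneg[OF assms, of 0 z] by simp
qed

lemma psd_schur_complement:
  assumes "psd (bordered 1 x X)"
  shows "psd (X - self_outer x)"
  unfolding psd_def symmetric_mat_iff
proof (intro conjI allI)
  show "(X - self_outer x) $ i $ j = (X - self_outer x) $ j $ i" for i j
    using psd_sym[OF psd_bordered_block[OF assms], of i j]
    by (simp add: self_outer_def mult.commute)
next
  fix z
  have "self_outer x \<bullet> self_outer z = (x \<bullet> z)\<^sup>2"
    by (simp add: inner_vec_def self_outer_def power2_eq_square sum_product mult_ac)
  then have "z \<bullet> ((X - self_outer x) *v z) = z \<bullet> (X *v z) - (x \<bullet> z)\<^sup>2"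
    by (simp only: inner_self_outer[symmetric] inner_diff_left)
  \<comment> \<open>\<open>t = - x\<^sup>Tz\<close> minimizes the bordered quadratic form at \<open>(t, z)\<close>\<close>
  then show "0 \<le> z \<bullet> ((X - self_outer x) *v z)"
    using bordered_form_nonneg[OF assms, of "- (x \<bullet> z)" z] by (simp add: power2_eq_square)
qed

section \<open>The semidefinite program bounds every convexified problem\<close>

lemma convexified_le:
  assumes "psd T" "psd (bordered 1 x X)"
  shows "T \<bullet> self_outer x + (Q - T) \<bullet> X \<le> Q \<bullet> X"
  using psd_inner_nonneg[OF assms(1) psd_schur_complement[OF assms(2)]]
  by (simp add: inner_diff_left inner_diff_right)

text \<open>
  The box constraints are not listed in the semidefinite program; they follow from
  \<open>x\<^sub>i\<^sup>2 \<le> X\<^sub>i\<^sub>i \<le> (u\<^sub>i + \<ell>\<^sub>i) x\<^sub>i - u\<^sub>i \<ell>\<^sub>i\<close>, that is, \<open>(x\<^sub>i - \<ell>\<^sub>i) (x\<^sub>i - u\<^sub>i) \<le> 0\<close>.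
\<close>

lemma feasible_SDP_box:
  assumes "(x, X) \<in> feasible_SDP m Q c b l u" "l $ i \<le> u $ i"
  shows "l $ i \<le> x $ i \<and> x $ i \<le> u $ i"
proof -
  have "X $ i $ i - u $ i * x $ i - l $ i * x $ i + u $ i * l $ i \<le> 0"
    and "psd (bordered 1 x X)"
    using assms(1) by (auto simp: feasible_SDP_def)
  moreover have "x $ i * x $ i \<le> X $ i $ i"
    using psd_diag_nonneg[OF psd_schur_complement[OF \<open>psd (bordered 1 x X)\<close>], of i]
    by (simp add: self_outer_def)
  ultimately have "(x $ i - l $ i) * (x $ i - u $ i) \<le> 0"
    by (simp add: algebra_simps)
  then show ?thesis
    using assms(2) by (auto simp: mult_le_0_iff)
qed

lemma mccormick_diag:
  "mccormick l u 1 i i x Y = Y $ i $ i - u $ i * x $ i - l $ i * x $ i + u $ i * l $ i"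
  "mccormick l u 2 i i x Y = mccormick l u 1 i i x Y"
  "mccormick l u 3 i i x Y = - Y $ i $ i + 2 * u $ i * x $ i - (u $ i)\<^sup>2"
  "mccormick l u 4 i i x Y = - Y $ i $ i + 2 * l $ i * x $ i - (l $ i)\<^sup>2"
  by (simp_all add: mccormick_def power2_eq_square)

lemma feasible_SDP_subset_feasible_P':
  assumes "\<forall>i. l $ i \<le> u $ i" "\<forall>r\<le>m. psd (T r)"
  shows "feasible_SDP m Q c b l u \<subseteq> feasible_P' m Q c b l u T"
proof (rule subrelI)
  fix x X
  assume fea: "(x, X) \<in> feasible_SDP m Q c b l u"
  then have bord: "psd (bordered 1 x X)"
    and sym: "symmetric_mat X"
    and lin: "\<forall>r\<in>{1..m}. Q r \<bullet> X + c r \<bullet> x \<le> b r"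
    and diag: "\<forall>i. X$i$i - u$i * x$i - l$i * x$i + u$i * l$i \<le> 0 \<and>
           - X$i$i + 2 * u$i * x$i - (u$i)\<^sup>2 \<le> 0 \<and>
           - X$i$i + 2 * l$i * x$i - (l$i)\<^sup>2 \<le> 0"
    and mcc: "\<forall>i j. i < j \<longrightarrow> (\<forall>t\<in>{1..4}. mccormick l u t i j x X \<le> 0)"
    and tri: "\<forall>i j k. i < j \<and> j < k \<longrightarrow> (\<forall>t\<in>{1..12}. triangle_fun l u t i j k x X \<le> 0)"
    unfolding feasible_SDP_def by auto
  have quad: "T r \<bullet> self_outer x + c r \<bullet> x + (Q r - T r) \<bullet> X \<le> b r" if "r \<in> {1..m}" for r
  proof -
    have "psd (T r)" using assms(2) that by simp
    from convexified_le[OF this bord, of "Q r"] show ?thesis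
      using bspec[OF lin that] by linarith
  qed
  have mcc': "mccormick l u t i j x X \<le> 0" if "i \<le> j" "t \<in> {1..4}" for i j t
  proof (cases "i = j")
    case True
    have "t = 1 \<or> t = 2 \<or> t = 3 \<or> t = 4" using that(2) by auto
    then show ?thesis using diag True by (auto simp only: mccormick_diag)
  next
    case False
    then show ?thesis using mcc that by auto
  qed
  have "X $ j $ i = X $ i $ j" for i j
    using sym unfolding symmetric_mat_iff by blast
  then show "(x, X) \<in> feasible_P' m Q c b l u T"
    unfolding feasible_P'_def
    using feasible_SDP_box[OF fea] assms(1) quad mcc' tri by blast
qed

lemma value_P'_le_value_SDP:
  assumes "\<forall>i. l $ i \<le> u $ i" "\<forall>r\<le>m. psd (T r)"
  shows "value_P' m Q c b l u T \<le> value_SDP m Q c b l u"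
  unfolding value_SDP_def
proof (rule INF_greatest, clarify)
  fix x X
  assume fea: "(x, X) \<in> feasible_SDP m Q c b l u"
  then have bord: "psd (bordered 1 x X)" by (simp add: feasible_SDP_def)
  have mem: "(x, X) \<in> feasible_P' m Q c b l u T"
    using feasible_SDP_subset_feasible_P'[OF assms] fea by blast
  have "value_P' m Q c b l u T \<le> ereal (T 0 \<bullet> self_outer x + c 0 \<bullet> x + (Q 0 - T 0) \<bullet> X)"
    unfolding value_P'_def by (rule INF_lower2[OF mem]) simp
  also have "T 0 \<bullet> self_outer x + c 0 \<bullet> x + (Q 0 - T 0) \<bullet> X \<le> Q 0 \<bullet> X + c 0 \<bullet> x"
    using convexified_le[OF _ bord, of "T 0" "Q 0"] assms(2) by simp
  finally show "value_P' m Q c b l u T \<le> ereal (Q 0 \<bullet> X + c 0 \<bullet> x)"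
    by simp
qed

section \<open>Lagrangian lower bound\<close>

lemma has_coeffs_apply:
  assumes "has_coeffs h (M, v, a)" "symmetric_mat Y"
  shows "M \<bullet> Y + v \<bullet> x + a = h x Y"
  using assms by (simp add: has_coeffs_def)

lemma weighted_coeffs:
  assumes "\<And>p t. has_coeffs (h p t) (M p t, v p t, a p t)" "symmetric_mat Y"
  shows "(\<Sum>p\<in>A. \<Sum>t\<in>T. w p t *\<^sub>R M p t) \<bullet> Y + (\<Sum>p\<in>A. \<Sum>t\<in>T. w p t *\<^sub>R v p t) \<bullet> x
      + (\<Sum>p\<in>A. \<Sum>t\<in>T. w p t * a p t)
    = (\<Sum>p\<in>A. \<Sum>t\<in>T. w p t * h p t x Y)"
  by (simp add: inner_sum_left sum.distrib[symmetric] distrib_left[symmetric]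
      has_coeffs_apply[OF assms])

lemma inner_diag_mat: "diag_mat e \<bullet> Y = (\<Sum>i\<in>UNIV. e $ i * Y $ i $ i)"
proof -
  have "(if i = j then e $ i else 0) * y = (if i = j then e $ i * y else 0)" for i j y
    by simp
  then show ?thesis by (simp add: diag_mat_def inner_vec_def)
qed

text \<open>
  Both sides are the Lagrangian of the semidefinite program, grouped by \<open>Y\<close>, \<open>x\<close> and constants on
  the left and by constraints on the right. With nonnegative multipliers, each constraint group is
  nonpositive wherever its constraints hold, so the left side then bounds the objective from below.
  At \<open>i = j\<close> the first two McCormick functions agree, so three multipliers per diagonal entry suffice.
\<close>

lemma lagrangian_eq:
  fixes Y :: "'n::{finite,linorder} rmat"
  assumes "symmetric_mat Y"
  shows "dual_mat m Q l u \<alpha> \<phi>1 \<phi>2 \<phi>3 \<phi> \<delta> \<bullet> Y + dual_vec m c l u \<alpha> \<phi>1 \<phi>2 \<phi>3 \<phi> \<delta> \<bullet> x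
      + (dual_obj m b l u \<alpha> \<phi>1 \<phi>2 \<phi>3 \<phi> \<delta> \<rho> + \<rho>)
    = Q 0 \<bullet> Y + c 0 \<bullet> x
      + (\<Sum>r=1..m. \<alpha> r * (Q r \<bullet> Y + c r \<bullet> x - b r))
      + (\<Sum>(i, j)\<in>pairs. \<Sum>t=1..4. \<phi> t i j * mccormick l u t i j x Y)
      + (\<Sum>(i, j, k)\<in>triples. \<Sum>t=1..12. \<delta> t i j k * triangle_fun l u t i j k x Y)
      + (\<Sum>i\<in>UNIV. \<phi>1 $ i * mccormick l u 1 i i x Y + \<phi>2 $ i * mccormick l u 3 i i x Y
                     + \<phi>3 $ i * mccormick l u 4 i i x Y)"
proof -
  have mcc: "(\<Sum>(i, j)\<in>pairs. \<Sum>t=1..4. \<phi> t i j *\<^sub>R mat_coeff (mccormick l u t i j)) \<bullet> Y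
      + (\<Sum>(i, j)\<in>pairs. \<Sum>t=1..4. \<phi> t i j *\<^sub>R vec_coeff (mccormick l u t i j)) \<bullet> x
      + (\<Sum>(i, j)\<in>pairs. \<Sum>t=1..4. \<phi> t i j * const_coeff (mccormick l u t i j))
    = (\<Sum>(i, j)\<in>pairs. \<Sum>t=1..4. \<phi> t i j * mccormick l u t i j x Y)"
    unfolding split_beta by (rule weighted_coeffs[OF mccormick_coeffs assms])
  have tri: "(\<Sum>(i, j, k)\<in>triples. \<Sum>t=1..12. \<delta> t i j k *\<^sub>R mat_coeff (triangle_fun l u t i j k)) \<bullet> Y
      + (\<Sum>(i, j, k)\<in>triples. \<Sum>t=1..12. \<delta> t i j k *\<^sub>R vec_coeff (triangle_fun l u t i j k)) \<bullet> x
      + (\<Sum>(i, j, k)\<in>triples. \<Sum>t=1..12. \<delta> t i j k * const_coeff (triangle_fun l u t i j k))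
    = (\<Sum>(i, j, k)\<in>triples. \<Sum>t=1..12. \<delta> t i j k * triangle_fun l u t i j k x Y)"
    unfolding split_beta by (rule weighted_coeffs[OF triangle_fun_coeffs assms])
  have lin: "(\<Sum>r=1..m. \<alpha> r *\<^sub>R Q r) \<bullet> Y + (\<Sum>r=1..m. \<alpha> r *\<^sub>R c r) \<bullet> x - (\<Sum>r=1..m. \<alpha> r * b r)
    = (\<Sum>r=1..m. \<alpha> r * (Q r \<bullet> Y + c r \<bullet> x - b r))"
    by (simp add: inner_sum_left sum.distrib sum_subtractf algebra_simps)
  have diag: "diag_mat (\<phi>1 - \<phi>2 - \<phi>3) \<bullet> Y
      + (\<chi> i. - (u$i + l$i) * \<phi>1$i + 2 * u$i * \<phi>2$i + 2 * l$i * \<phi>3$i) \<bullet> x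
      + (\<Sum>i\<in>UNIV. u$i * l$i * \<phi>1$i - (u$i)\<^sup>2 * \<phi>2$i - (l$i)\<^sup>2 * \<phi>3$i)
    = (\<Sum>i\<in>UNIV. \<phi>1 $ i * mccormick l u 1 i i x Y + \<phi>2 $ i * mccormick l u 3 i i x Y
                     + \<phi>3 $ i * mccormick l u 4 i i x Y)"
    unfolding inner_diag_mat unfolding mccormick_diag inner_vec_def sum.distrib[symmetric]
    by (rule sum.cong) (simp_all add: algebra_simps)
  show ?thesis
    unfolding dual_mat_def dual_vec_def dual_obj_def Phi_mat_def Delta_mat_def inner_add_left
      mcc[symmetric] tri[symmetric] lin[symmetric] diag[symmetric]
    by simp
qed

lemma dual_obj_le_value_P':
  assumes D: "feasible_D m Q c l u \<alpha> \<phi>1 \<phi>2 \<phi>3 \<phi> \<delta> \<rho>"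
    and S0: "S 0 = dual_mat m Q l u \<alpha> \<phi>1 \<phi>2 \<phi>3 \<phi> \<delta>"
    and Sr: "\<forall>r\<in>{1..m}. S r = 0"
  shows "ereal (dual_obj m b l u \<alpha> \<phi>1 \<phi>2 \<phi>3 \<phi> \<delta> \<rho>) \<le> value_P' m Q c b l u S"
  unfolding value_P'_def
proof (rule INF_greatest, clarify)
  fix x Y
  assume fea: "(x, Y) \<in> feasible_P' m Q c b l u S"
  let ?d = "dual_vec m c l u \<alpha> \<phi>1 \<phi>2 \<phi>3 \<phi> \<delta>"
  let ?obj = "dual_obj m b l u \<alpha> \<phi>1 \<phi>2 \<phi>3 \<phi> \<delta> \<rho>"
  have half: "\<forall>i j. i < j \<longrightarrow> Y $ j $ i = Y $ i $ j"
    and quad: "\<forall>r\<in>{1..m}. S r \<bullet> self_outer x + c r \<bullet> x + (Q r - S r) \<bullet> Y \<le> b r"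
    and mcc: "\<And>i j t. \<lbrakk>i \<le> j; t \<in> {1..4}\<rbrakk> \<Longrightarrow> mccormick l u t i j x Y \<le> 0"
    and tri: "\<And>i j k t. \<lbrakk>i < j; j < k; t \<in> {1..12}\<rbrakk> \<Longrightarrow> triangle_fun l u t i j k x Y \<le> 0"
    using fea unfolding feasible_P'_def by blast+
  have nonneg: "\<forall>r\<in>{1..m}. 0 \<le> \<alpha> r" "\<forall>i. 0 \<le> \<phi>1 $ i \<and> 0 \<le> \<phi>2 $ i \<and> 0 \<le> \<phi>3 $ i"
    "\<And>i j t. \<lbrakk>i < j; t \<in> {1..4}\<rbrakk> \<Longrightarrow> 0 \<le> \<phi> t i j"
    "\<And>i j k t. \<lbrakk>i < j; j < k; t \<in> {1..12}\<rbrakk> \<Longrightarrow> 0 \<le> \<delta> t i j k"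
    and bord: "psd (bordered \<rho> ((1/2) *\<^sub>R ?d) (S 0))"
    using D unfolding feasible_D_def S0 by blast+
  have symY: "symmetric_mat Y"
    unfolding symmetric_mat_iff using half by (metis linorder_neqE)
  have lin: "(\<Sum>r=1..m. \<alpha> r * (Q r \<bullet> Y + c r \<bullet> x - b r)) \<le> 0"
  proof (rule sum_nonpos)
    fix r assume r: "r \<in> {1..m}"
    have "S r = 0" using bspec[OF Sr r] .
    then have "Q r \<bullet> Y + c r \<bullet> x - b r \<le> 0"
      using bspec[OF quad r] by simp
    then show "\<alpha> r * (Q r \<bullet> Y + c r \<bullet> x - b r) \<le> 0"
      using bspec[OF nonneg(1) r] by (rule mult_nonneg_nonpos[rotated])
  qed
  have phi: "(\<Sum>(i, j)\<in>pairs. \<Sum>t=1..4. \<phi> t i j * mccormick l u t i j x Y) \<le> 0"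
    by (rule sum_nonpos)
      (auto simp: pairs_def intro!: sum_nonpos mult_nonneg_nonpos nonneg mcc)
  have delta: "(\<Sum>(i, j, k)\<in>triples. \<Sum>t=1..12. \<delta> t i j k * triangle_fun l u t i j k x Y) \<le> 0"
    by (rule sum_nonpos)
      (auto simp: triples_def intro!: sum_nonpos mult_nonneg_nonpos nonneg tri)
  have diag: "(\<Sum>i\<in>UNIV. \<phi>1 $ i * mccormick l u 1 i i x Y + \<phi>2 $ i * mccormick l u 3 i i x Y
                     + \<phi>3 $ i * mccormick l u 4 i i x Y) \<le> 0"
    using nonneg(2) by (intro sum_nonpos add_nonpos_nonpos mult_nonneg_nonpos mcc) auto
  have "S 0 \<bullet> Y + ?d \<bullet> x + (?obj + \<rho>) \<le> Q 0 \<bullet> Y + c 0 \<bullet> x"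
    unfolding S0 lagrangian_eq[OF symY] using lin phi delta diag by linarith
  moreover have "0 \<le> \<rho> + ?d \<bullet> x + S 0 \<bullet> self_outer x"
    using bordered_form_nonneg[OF bord, of 1 x] by (simp add: inner_self_outer)
  ultimately have "?obj \<le> S 0 \<bullet> self_outer x + c 0 \<bullet> x + (Q 0 - S 0) \<bullet> Y"
    unfolding inner_diff_left by linarith
  then show "ereal ?obj \<le> ereal (S 0 \<bullet> self_outer x + c 0 \<bullet> x + (Q 0 - S 0) \<bullet> Y)"
    by simp
qed

section \<open>Optimality of the dual matrices\<close>

theorem corollary1:
  fixes m :: nat
    and Q :: "nat \<Rightarrow> 'n::{finite,linorder} rmat"
    and c :: "nat \<Rightarrow> 'n rvec"
    and b :: "nat \<Rightarrow> real"
    and l u :: "'n rvec"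
    and \<alpha> :: "nat \<Rightarrow> real"
    and \<phi>1 \<phi>2 \<phi>3 :: "'n rvec"
    and \<phi> :: "nat \<Rightarrow> 'n \<Rightarrow> 'n \<Rightarrow> real"
    and \<delta> :: "nat \<Rightarrow> 'n \<Rightarrow> 'n \<Rightarrow> 'n \<Rightarrow> real"
    and S :: "nat \<Rightarrow> 'n rmat"
  assumes "\<forall>r\<le>m. symmetric_mat (Q r)"
    and "\<forall>i. 0 \<le> l$i \<and> l$i \<le> u$i"
    and "feasible_P m Q c b l u \<noteq> {}"
    and "optimal_dual_vars m Q c b l u \<alpha> \<phi>1 \<phi>2 \<phi>3 \<phi> \<delta>"
    and "\<forall>r\<in>{1..m}. S r = 0"
    and "S 0 = Q 0 + (\<Sum>r=1..m. \<alpha> r *\<^sub>R Q r) + Phi_mat l u \<phi>1 \<phi>2 \<phi>3 \<phi> + Delta_mat l u \<delta>"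
  shows "(\<forall>r\<le>m. psd (S r)) \<and> optimal_OPT m Q c b l u S"
proof -
  obtain \<rho> where D: "feasible_D m Q c l u \<alpha> \<phi>1 \<phi>2 \<phi>3 \<phi> \<delta> \<rho>"
    and gap: "ereal (dual_obj m b l u \<alpha> \<phi>1 \<phi>2 \<phi>3 \<phi> \<delta> \<rho>) = value_SDP m Q c b l u"
    using assms(4) unfolding optimal_dual_vars_def by blast
  have S0: "S 0 = dual_mat m Q l u \<alpha> \<phi>1 \<phi>2 \<phi>3 \<phi> \<delta>"
    using assms(6) by (simp add: dual_mat_def)
  have "psd (S 0)"
    using D unfolding feasible_D_def S0 by (blast intro: psd_bordered_block)
  moreover have "psd (S r)" if "r \<in> {1..m}" for r
    using assms(5) that psd_zero by simp
  ultimately have psd: "\<forall>r\<le>m. psd (S r)"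
    by (metis One_nat_def Suc_leI atLeastAtMost_iff neq0_conv)
  have "value_P' m Q c b l u T \<le> value_P' m Q c b l u S" if "\<forall>r\<le>m. psd (T r)" for T
  proof -
    have "value_P' m Q c b l u T \<le> value_SDP m Q c b l u"
      using assms(2) that by (intro value_P'_le_value_SDP) auto
    also have "\<dots> \<le> value_P' m Q c b l u S"
      unfolding gap[symmetric] using D S0 assms(5) by (rule dual_obj_le_value_P')
    finally show ?thesis .
  qed
  with psd show ?thesis
    unfolding optimal_OPT_def by blast
qed

end
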